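(* Let $K\in\mathbb{R}_{>0}$ and $c>1$. Consider a problem instance in the class $I_{\text{sub}}$ such that for every $t\in\mathcal{T}$ we have $f^t(x^t)=a^t\bar{f}^t\big(\frac{x^t}{a^t}+b^t\big)$ with $\bar{f}^t(y)=Ky^c$ and parameters $a^t\in\mathbb{R}_{>0}$, $b^t\in\mathbb{R}$. Let $(\mu^*,\lambda^* )$ be optimal Lagrange multipliers and let $(\hat{\mu},\hat{\lambda})$ be Lagrange multipliers with $(\hat{\mu},\hat{\lambda})\le(\mu^*,\lambda^* )$ component-wise. Assume that for every $t\in\mathcal{T}$ the values $\nu^t(\hat{\mu},\hat{\lambda})$ and $\nu^t(\mu^*,\lambda^* )$ lie in the range of $\nabla f^t$. Then $$\sum_{t \in \mathcal{T}} f^t\big((\nabla f^t)^{-1}(\nu^t(\hat{\mu},\hat{\lambda}))\big) - \sum_{t \in \mathcal{T}} f^t\big((\nabla f^t)^{-1}(\nu^t(\mu^*,\lambda^* ))\big)=K \left(\frac{1}{cK}\right)^{\frac{c}{c-1}} \left( \sum_{t \in \mathcal{T}} a^t (\nu^t(\hat{\mu},\hat{\lambda}))^{\frac{c}{c-1}} - \sum_{t \in \mathcal{T}} a^t (\nu^t(\mu^*,\lambda^* ))^{\frac{c}{c-1}} \right),$$ and consequently $$\sum_{t \in \mathcal{T}} f^t (\hat{x}^t(\hat{\mu},\hat{\lambda})) - \sum_{t \in \mathcal{T}} f^t (\hat{x}^t(\mu^*,\lambda^* )) \leq K \left(\frac{1}{cK}\right)^{\frac{c}{c-1}} \left( \sum_{t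 \in \mathcal{T}} a^t (\nu^t(\hat{\mu},\hat{\lambda}))^{\frac{c}{c-1}} - \sum_{t \in \mathcal{T}} a^t (\nu^t(\mu^*,\lambda^* ))^{\frac{c}{c-1}} \right).$$
   Context: Let $T\ge 1$ be an integer and $\mathcal{T}=\{1,\ldots,T\}$. A function $r:2^{\mathcal{T}}\to\mathbb{R}$ is submodular if $r(\mathcal{X}\cup\mathcal{Y})+r(\mathcal{X}\cap\mathcal{Y})\le r(\mathcal{X})+r(\mathcal{Y})$ for all $\mathcal{X},\mathcal{Y}\subseteq\mathcal{T}$; we assume $r(\emptyset)=0$. Its base polyhedron is $\mathcal{B}(r)=\{x\in\mathbb{R}^T : \sum_{t\in\mathcal{X}}x^t\le r(\mathcal{X})\ \forall \mathcal{X}\subset\mathcal{T},\ \sum_{t\in\mathcal{T}}x^t=r(\mathcal{T})\}$ (superscripts $t$ on $x$, $a$, $b$, $f$, $\nu$ are indices, while $y^c$ and $(\cdot)^{c/(c-1)}$ are powers). The class $I_{\text{sub}}$ consists of all problems $\min \sum_{t\in\mathcal{T}} f^t(x^t)$ subject to $x=(x^1,\ldots,x^T)\in\mathcal{B}(r)$, where $r$ is submodular on $\mathcal{T}$ and each $f^t$ is a real-valued increasing, strictly convex, continuously differentiable function of one real variable, defined on an interval $D^t\subseteq\mathbb{R}$ containing $\mathcal{C}^t:=[\,r(\mathcal{T})-r(\mathcal{T}\setminus\{t\}),\ r(\{t\})\,]$. Here $\bar f^t(y)=Ky^c$ is considered on (a subinterval of) $[0,\infty)$, where it is increasing; that is,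 $x/a^t+b^t\ge 0$ for all $x\in D^t$. Lagrange multipliers: let $\mathcal{M}=\{\mathcal{X}\subseteq\mathcal{T}: 1<|\mathcal{X}|<T\}$. A vector of Lagrange multipliers is $(\mu,\lambda)$ with $\mu=(\mu_{\mathcal{X}})_{\mathcal{X}\in\mathcal{M}}$ (for the constraints $\sum_{t\in\mathcal{X}}x^t\le r(\mathcal{X})$) and a scalar $\lambda=\lambda_{\mathcal{T}}$ (for the constraint $\sum_{t\in\mathcal{T}}x^t=r(\mathcal{T})$). Put $\nu^t(\mu,\lambda):=-\sum_{\mathcal{X}\in\mathcal{M}:\,\mathcal{X}\ni t}\mu_{\mathcal{X}}-\lambda_{\mathcal{T}}$. Up to an additive constant, the local Lagrangian of stage $t$ is $L^t(x^t,\mu,\lambda)=f^t(x^t)-\nu^t(\mu,\lambda)\,x^t$. Local Lagrangian solution: $x^t(\mu,\lambda)$ is the unique minimizer of $L^t(\cdot,\mu,\lambda)$ over $\mathcal{C}^t$. The multipliers $(\mu^*,\lambda^* )$ are called optimal if $(x^t(\mu^*,\lambda^* ))_{t\in\mathcal{T}}$ is an optimal solution of the problem instance; it is assumed throughout that such multipliers exist. Online solution: $\hat{x}(\mu,\lambda)=(\hat{x}^1(\mu,\lambda),\ldots,\hat{x}^T(\mu,\lambda))$ is defined recursively for $\bar t=1,\ldots,T$: $\hat{x}^{\bar t}(\mu,\lambda)$ is the unique minimizer of $L^{\bar t}(\cdot,\mu,\lambda)$ over the set $\mathcal{C}^{\bar t}_{\text{proj}}$ of all $y\in\mathbb{R}$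 for which there exist $x^{\bar t+1},\ldots,x^T$ with $(\hat{x}^1(\mu,\lambda),\ldots,\hat{x}^{\bar t-1}(\mu,\lambda),y,x^{\bar t+1},\ldots,x^T)\in\mathcal{B}(r)$. $\nabla f^t$ denotes the derivative of $f^t$ on $D^t$ (one-sided at endpoints of $D^t$ that belong to it), and $(\nabla f^t)^{-1}$ is its inverse, defined on the range of $\nabla f^t$ and taking values in $D^t$. *)

theory Defs
  imports "HOL-Analysis.Analysis"
begin

text \<open>
  The ground set is \<open>{1..T}\<close>. A vector with one entry per stage is a function of type
  \<open>nat \<Rightarrow> real\<close>, of which only the values on \<open>{1..T}\<close> are meaningful: no definition below
  constrains or uses the other values. Likewise \<open>r\<close> is only used on subsets of \<open>{1..T}\<close>, and
  \<open>f t\<close> only on its domain \<open>D t\<close>.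
\<close>

definition submodular :: "nat \<Rightarrow> (nat set \<Rightarrow> real) \<Rightarrow> bool" where
  "submodular T r \<longleftrightarrow>
     (\<forall>X Y. X \<subseteq> {1..T} \<longrightarrow> Y \<subseteq> {1..T} \<longrightarrow> r (X \<union> Y) + r (X \<inter> Y) \<le> r X + r Y)"

definition base_polyhedron :: "nat \<Rightarrow> (nat set \<Rightarrow> real) \<Rightarrow> (nat \<Rightarrow> real) set" where
  "base_polyhedron T r =
     {x. (\<forall>X. X \<subset> {1..T} \<longrightarrow> (\<Sum>t\<in>X. x t) \<le> r X) \<and> (\<Sum>t\<in>{1..T}. x t) = r {1..T}}"

definition local_set :: "nat \<Rightarrow> (nat set \<Rightarrow> real) \<Rightarrow> nat \<Rightarrow> real set" where
  "local_set T r t = {r {1..T} - r ({1..T} - {t}) .. r {t}}"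

definition strictly_convex_on :: "real set \<Rightarrow> (real \<Rightarrow> real) \<Rightarrow> bool" where
  "strictly_convex_on S g \<longleftrightarrow> convex S \<and>
     (\<forall>x\<in>S. \<forall>y\<in>S. \<forall>u. x \<noteq> y \<longrightarrow> 0 < u \<longrightarrow> u < 1 \<longrightarrow>
        g ((1 - u) * x + u * y) < (1 - u) * g x + u * g y)"

text \<open>
  The derivative relative to \<open>S\<close> is one-sided at endpoints of an interval \<open>S\<close>. It is uniquely
  determined only if \<open>S\<close> has no isolated points, so it is used for nondegenerate intervals only.
\<close>

definition grad_on :: "real set \<Rightarrow> (real \<Rightarrow> real) \<Rightarrow> real \<Rightarrow> real" where
  "grad_on S g x = vector_derivative g (at x within S)"

definition continuously_differentiable_on :: "real set \<Rightarrow> (real \<Rightarrow> real) \<Rightarrow> bool" where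
  "continuously_differentiable_on S g \<longleftrightarrow> g differentiable_on S \<and> continuous_on S (grad_on S g)"

definition inv_grad_on :: "real set \<Rightarrow> (real \<Rightarrow> real) \<Rightarrow> real \<Rightarrow> real" where
  "inv_grad_on S g = inv_into S (grad_on S g)"

definition I_sub ::
  "nat \<Rightarrow> (nat set \<Rightarrow> real) \<Rightarrow> (nat \<Rightarrow> real set) \<Rightarrow> (nat \<Rightarrow> real \<Rightarrow> real) \<Rightarrow> bool" where
  "I_sub T r D f \<longleftrightarrow>
     1 \<le> T \<and> submodular T r \<and> r {} = 0 \<and>
     (\<forall>t\<in>{1..T}.
        is_interval (D t) \<and> interior (D t) \<noteq> {} \<and> local_set T r t \<subseteq> D t \<and>
        mono_on (D t) (f t) \<and> strictly_convex_on (D t) (f t) \<and>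
        continuously_differentiable_on (D t) (f t))"

definition total_cost :: "nat \<Rightarrow> (nat \<Rightarrow> real \<Rightarrow> real) \<Rightarrow> (nat \<Rightarrow> real) \<Rightarrow> real" where
  "total_cost T f x = (\<Sum>t\<in>{1..T}. f t (x t))"

definition optimal_solution ::
  "nat \<Rightarrow> (nat set \<Rightarrow> real) \<Rightarrow> (nat \<Rightarrow> real \<Rightarrow> real) \<Rightarrow> (nat \<Rightarrow> real) \<Rightarrow> bool" where
  "optimal_solution T r f x \<longleftrightarrow> is_arg_min (total_cost T f) (\<lambda>z. z \<in> base_polyhedron T r) x"

definition mult_sets :: "nat \<Rightarrow> nat set set" where
  "mult_sets T = {X. X \<subseteq> {1..T} \<and> 1 < card X \<and> card X < T}"

text \<open>
  A vector of multipliers consists of \<open>\<mu>\<close>, relevant only on \<open>mult_sets T\<close>, and the scalar \<open>\<lambda>\<close>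
  (written \<open>l\<close>). No sign condition is imposed on \<open>\<mu>\<close>.
\<close>

definition nu :: "nat \<Rightarrow> (nat set \<Rightarrow> real) \<Rightarrow> real \<Rightarrow> nat \<Rightarrow> real" where
  "nu T \<mu> l t = - (\<Sum>X\<in>{X \<in> mult_sets T. t \<in> X}. \<mu> X) - l"

definition mult_le ::
  "nat \<Rightarrow> (nat set \<Rightarrow> real) \<Rightarrow> real \<Rightarrow> (nat set \<Rightarrow> real) \<Rightarrow> real \<Rightarrow> bool" where
  "mult_le T \<mu> l \<mu>' l' \<longleftrightarrow> (\<forall>X\<in>mult_sets T. \<mu> X \<le> \<mu>' X) \<and> l \<le> l'"

definition local_lagrangian ::
  "nat \<Rightarrow> (nat \<Rightarrow> real \<Rightarrow> real) \<Rightarrow> (nat set \<Rightarrow> real) \<Rightarrow> real \<Rightarrow> nat \<Rightarrow> real \<Rightarrow> real" where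
  "local_lagrangian T f \<mu> l t y = f t y - nu T \<mu> l t * y"

text \<open>
  Below, \<open>arg_min_on\<close> picks the minimizer, which is unique because the local Lagrangians are
  strictly convex and the feasible sets are nonempty compact intervals.
\<close>

definition local_solution ::
  "nat \<Rightarrow> (nat set \<Rightarrow> real) \<Rightarrow> (nat \<Rightarrow> real \<Rightarrow> real) \<Rightarrow> (nat set \<Rightarrow> real) \<Rightarrow> real \<Rightarrow> nat \<Rightarrow> real"
  where
  "local_solution T r f \<mu> l t = arg_min_on (local_lagrangian T f \<mu> l t) (local_set T r t)"

definition optimal_multipliers ::
  "nat \<Rightarrow> (nat set \<Rightarrow> real) \<Rightarrow> (nat \<Rightarrow> real \<Rightarrow> real) \<Rightarrow> (nat set \<Rightarrow> real) \<Rightarrow> real \<Rightarrow> bool" where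
  "optimal_multipliers T r f \<mu> l \<longleftrightarrow> optimal_solution T r f (local_solution T r f \<mu> l)"

fun online_solution ::
  "nat \<Rightarrow> (nat set \<Rightarrow> real) \<Rightarrow> (nat \<Rightarrow> real \<Rightarrow> real) \<Rightarrow> (nat set \<Rightarrow> real) \<Rightarrow> real \<Rightarrow> nat \<Rightarrow> real"
  where
  "online_solution T r f \<mu> l t =
     arg_min_on (local_lagrangian T f \<mu> l t)
       {y. \<exists>x\<in>base_polyhedron T r.
             (\<forall>s\<in>{1..<t}. x s = online_solution T r f \<mu> l s) \<and> x t = y}"

declare online_solution.simps [simp del]

definition power_cost :: "real \<Rightarrow> real \<Rightarrow> real \<Rightarrow> real" where
  "power_cost K c y = K * y powr c"

end

theory Submission
  imports Defs
begin

text \<open>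
  Let \<open>w t \<le> u t\<close> be the stationary points of the two local Lagrangians, \<open>x\<close> the local (hence also the
  online) solution for the optimal multipliers and \<open>y\<close> the online solution for the smaller ones. The
  inequality holds stagewise, \<open>f t (y t) - f t (x t) \<le> f t (u t) - f t (w t)\<close>: it is trivial for
  \<open>y t \<le> x t\<close>, and for \<open>x t < y t\<close> it follows from \<open>w t \<le> x t < y t \<le> u t\<close>. Here \<open>y t \<le> u t\<close>
  is the point. Otherwise \<open>y t\<close> cannot be decreased, which yields a tight set that contains all
  later stages but not \<open>t\<close>; each earlier \<open>s\<close> with \<open>y s < x s\<close> cannot be increased, which yields a
  tight subset of \<open>{1..s}\<close> containing \<open>s\<close>. On the complement of the union of these tight sets \<open>x \<le> y\<close>
  with strict inequality at \<open>t\<close>, whereas tightness of the union forces the sum of \<open>x\<close> over that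
  complement to be at least that of \<open>y\<close>.
\<close>

section \<open>Tight sets of a base\<close>

definition tight :: "nat \<Rightarrow> (nat set \<Rightarrow> real) \<Rightarrow> (nat \<Rightarrow> real) \<Rightarrow> nat set \<Rightarrow> bool" where
  "tight T r x X \<longleftrightarrow> X \<subseteq> {1..T} \<and> sum x X = r X"

lemma base_polyhedron_sum_le:
  assumes "x \<in> base_polyhedron T r" "X \<subseteq> {1..T}"
  shows "sum x X \<le> r X"
  using assms by (cases "X = {1..T}") (auto simp: base_polyhedron_def)

text \<open>Vectors are total functions on \<open>nat\<close>, so values outside the ground set must
  be replaceable: for truncation to a compact box and for assembling the online solution.\<close>

lemma base_polyhedron_cong:
  assumes "x \<in> base_polyhedron T r" "\<And>t. t \<in> {1..T} \<Longrightarrow> x t = z t"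
  shows "z \<in> base_polyhedron T r"
proof -
  have "sum x X = sum z X" if "X \<subseteq> {1..T}" for X
    using assms(2) that by (intro sum.cong) auto
  with assms(1) show ?thesis by (auto simp: base_polyhedron_def psubset_eq)
qed

text \<open>The lower bound comes from subtracting the constraint for the complement of
  \<open>t\<close> from the equation for the ground set.\<close>

lemma base_polyhedron_local_set:
  assumes "x \<in> base_polyhedron T r" "t \<in> {1..T}"
  shows "x t \<in> local_set T r t"
proof -
  have "sum x {1..T} = x t + sum x ({1..T} - {t})"
    using assms(2) by (intro sum.remove) auto
  moreover have "sum x ({1..T} - {t}) \<le> r ({1..T} - {t})"
    using assms by (intro base_polyhedron_sum_le) auto
  moreover have "sum x {t} \<le> r {t}"
    using assms by (intro base_polyhedron_sum_le) auto
  moreover have "sum x {1..T} = r {1..T}"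
    using assms by (simp add: base_polyhedron_def)
  ultimately show ?thesis by (simp add: local_set_def)
qed

text \<open>Sums are modular and \<open>r\<close> is submodular, so the slacks of union and
  intersection are nonnegative with total at most zero; both vanish.\<close>

lemma tight_Un_Int:
  assumes sub: "submodular T r" and x: "x \<in> base_polyhedron T r"
    and X: "tight T r x X" and Y: "tight T r x Y"
  shows "tight T r x (X \<union> Y)" "tight T r x (X \<inter> Y)"
proof -
  have XY: "X \<subseteq> {1..T}" "Y \<subseteq> {1..T}"
    using X Y by (auto simp: tight_def)
  have "finite X" "finite Y"
    using XY finite_subset by blast+
  then have "sum x (X \<union> Y) + sum x (X \<inter> Y) = sum x X + sum x Y"
    by (rule sum.union_inter)
  moreover have "r (X \<union> Y) + r (X \<inter> Y) \<le> r X + r Y"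
    using sub XY by (auto simp: submodular_def)
  moreover have "sum x (X \<union> Y) \<le> r (X \<union> Y)" "sum x (X \<inter> Y) \<le> r (X \<inter> Y)"
    using XY by (auto intro!: base_polyhedron_sum_le[OF x])
  moreover have "sum x X = r X" "sum x Y = r Y"
    using X Y by (auto simp: tight_def)
  ultimately have "sum x (X \<union> Y) = r (X \<union> Y)" "sum x (X \<inter> Y) = r (X \<inter> Y)"
    by linarith+
  then show "tight T r x (X \<union> Y)" "tight T r x (X \<inter> Y)"
    using XY by (auto simp: tight_def)
qed

lemma tight_UN:
  assumes "submodular T r" "r {} = 0" "x \<in> base_polyhedron T r"
    and "finite I" "\<And>i. i \<in> I \<Longrightarrow> tight T r x (Z i)"
  shows "tight T r x (\<Union>i\<in>I. Z i)"
  using assms(4,5)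
proof (induction I rule: finite_induct)
  case empty
  show ?case using assms(2) by (simp add: tight_def)
next
  case (insert i I)
  then show ?case using tight_Un_Int(1)[OF assms(1,3)] by simp
qed

text \<open>The factor \<open>{1..T}\<close> makes the empty family yield the ground set, which is
  tight for every base.\<close>

lemma tight_INT:
  assumes "submodular T r" "x \<in> base_polyhedron T r"
    and "finite I" "\<And>i. i \<in> I \<Longrightarrow> tight T r x (Z i)"
  shows "tight T r x ({1..T} \<inter> (\<Inter>i\<in>I. Z i))"
  using assms(3,4)
proof (induction I rule: finite_induct)
  case empty
  show ?case using assms(2) by (simp add: tight_def base_polyhedron_def)
next
  case (insert i I)
  have "{1..T} \<inter> (\<Inter>j\<in>insert i I. Z j) = Z i \<inter> ({1..T} \<inter> (\<Inter>j\<in>I. Z j))" by auto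
  with insert show ?case using tight_Un_Int(2)[OF assms(1,2)] by simp
qed

text \<open>Only the constraints of sets with \<open>p\<close> inside and \<open>q\<close> outside
  get harder under the shift. None of these finitely many sets is tight, so a positive shift fits
  into the least slack.\<close>

lemma base_polyhedron_exchange:
  assumes y: "y \<in> base_polyhedron T r" and pq: "p \<in> {1..T}" "q \<in> {1..T}" "p \<noteq> q"
    and nt: "\<And>X. tight T r y X \<Longrightarrow> p \<in> X \<Longrightarrow> q \<in> X" and e: "0 < e"
  obtains \<delta> where "0 < \<delta>" "\<delta> \<le> e" "y(p := y p + \<delta>, q := y q - \<delta>) \<in> base_polyhedron T r"
proof -
  define S where "S = {X. X \<subseteq> {1..T} \<and> p \<in> X \<and> q \<notin> X}"
  \<comment> \<open>The cap \<open>e\<close> lets callers keep the moved coordinate in a prescribed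
    window.\<close>
  define \<delta> where "\<delta> = Min (insert e ((\<lambda>X. r X - sum y X) ` S))"
  define z where "z = (\<lambda>i. y i + (if i = p then \<delta> else 0) - (if i = q then \<delta> else 0))"
  have fin: "finite (insert e ((\<lambda>X. r X - sum y X) ` S))"
    unfolding S_def by simp
  have slack: "sum y X < r X" if "X \<in> S" for X
    using that nt[of X] base_polyhedron_sum_le[OF y, of X] by (force simp: S_def tight_def)
  have pos: "0 < \<delta>"
    unfolding \<delta>_def using fin e slack by (subst Min_gr_iff) auto
  have le: "\<delta> \<le> e"
    unfolding \<delta>_def using fin by (intro Min_le) auto
  have room: "\<delta> \<le> r X - sum y X" if "X \<in> S" for X
    unfolding \<delta>_def using fin that by (intro Min_le) auto
  have sum_z: "sum z X = sum y X + (if p \<in> X then \<delta> else 0) - (if q \<in> X then \<delta> else 0)"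
    if "X \<subseteq> {1..T}" for X
  proof -
    have "finite X" using that finite_subset by blast
    then show ?thesis by (simp add: z_def sum.distrib sum_subtractf)
  qed
  have "sum z X \<le> r X" if "X \<subseteq> {1..T}" for X
    using sum_z[OF that] room[of X] base_polyhedron_sum_le[OF y that] pos that
    by (auto simp: S_def split: if_splits)
  moreover have "sum z {1..T} = r {1..T}"
    using sum_z[of "{1..T}"] pq y by (simp add: base_polyhedron_def)
  ultimately have "z \<in> base_polyhedron T r" by (auto simp: base_polyhedron_def)
  moreover have "z = y(p := y p + \<delta>, q := y q - \<delta>)"
    using pq by (auto simp: z_def)
  ultimately show ?thesis using that pos le by simp
qed

text \<open>For each later stage \<open>q\<close> some tight set contains \<open>s\<close> and
  avoids \<open>q\<close>: otherwise mass could be shifted from \<open>q\<close> to \<open>s\<close>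
  without touching earlier stages, and a small shift lands in the forbidden window. Intersecting
  over all \<open>q\<close> leaves only stages up to \<open>s\<close>.\<close>

lemma tight_prefix_of_no_increase:
  assumes "submodular T r" "y \<in> base_polyhedron T r" "s \<in> {1..T}" "y s < d"
    and max: "\<And>z. z \<in> base_polyhedron T r \<Longrightarrow> (\<forall>q\<in>{1..<s}. z q = y q) \<Longrightarrow> z s \<notin> {y s<..d}"
  obtains Z where "tight T r y Z" "s \<in> Z" "Z \<subseteq> {1..s}"
proof -
  have "\<exists>X. tight T r y X \<and> s \<in> X \<and> q \<notin> X" if q: "q \<in> {s<..T}" for q
  proof (rule ccontr)
    assume "\<not> ?thesis"
    then have nt: "q \<in> X" if "tight T r y X" "s \<in> X" for X using that by blast
    have sq: "q \<in> {1..T}" "s \<noteq> q" "0 < d - y s" using q assms(4) by auto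
    obtain \<delta> where \<delta>: "0 < \<delta>" "\<delta> \<le> d - y s"
      "y(s := y s + \<delta>, q := y q - \<delta>) \<in> base_polyhedron T r"
      by (rule base_polyhedron_exchange[OF assms(2,3) sq(1,2) nt sq(3)])
    then show False using max[OF \<delta>(3)] q by auto
  qed
  then obtain Z where Z: "\<And>q. q \<in> {s<..T} \<Longrightarrow> tight T r y (Z q) \<and> s \<in> Z q \<and> q \<notin> Z q" by metis
  show ?thesis
  proof (rule that)
    show "tight T r y ({1..T} \<inter> (\<Inter>q\<in>{s<..T}. Z q))"
      using Z by (intro tight_INT assms) auto
    show "s \<in> {1..T} \<inter> (\<Inter>q\<in>{s<..T}. Z q)" using Z assms(3) by auto
    show "{1..T} \<inter> (\<Inter>q\<in>{s<..T}. Z q) \<subseteq> {1..s}"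
    proof
      fix q assume q: "q \<in> {1..T} \<inter> (\<Inter>q\<in>{s<..T}. Z q)"
      then have "\<not> s < q" using Z[of q] by auto
      with q show "q \<in> {1..s}" by simp
    qed
  qed
qed

text \<open>Dual argument: a shift from \<open>t\<close> to a later \<open>q\<close> is blocked by a
  tight set with \<open>q\<close> inside and \<open>t\<close> outside, and the union over all
  \<open>q\<close> is taken. For \<open>t = T\<close> it is the empty set, tight because
  \<open>r {} = 0\<close>.\<close>

lemma tight_suffix_of_no_decrease:
  assumes "submodular T r" "r {} = 0" "y \<in> base_polyhedron T r" "t \<in> {1..T}" "d < y t"
    and min: "\<And>z. z \<in> base_polyhedron T r \<Longrightarrow> (\<forall>q\<in>{1..<t}. z q = y q) \<Longrightarrow> z t \<notin> {d..<y t}"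
  obtains Z where "tight T r y Z" "t \<notin> Z" "{t<..T} \<subseteq> Z"
proof -
  have "\<exists>X. tight T r y X \<and> q \<in> X \<and> t \<notin> X" if q: "q \<in> {t<..T}" for q
  proof (rule ccontr)
    assume "\<not> ?thesis"
    then have nt: "t \<in> X" if "tight T r y X" "q \<in> X" for X using that by blast
    have tq: "q \<in> {1..T}" "q \<noteq> t" "0 < y t - d" using q assms(5) by auto
    obtain \<delta> where \<delta>: "0 < \<delta>" "\<delta> \<le> y t - d"
      "y(q := y q + \<delta>, t := y t - \<delta>) \<in> base_polyhedron T r"
      by (rule base_polyhedron_exchange[OF assms(3) tq(1) assms(4) tq(2) nt tq(3)])
    then show False using min[OF \<delta>(3)] q by auto
  qed
  then obtain Z where Z: "\<And>q. q \<in> {t<..T} \<Longrightarrow> tight T r y (Z q) \<and> q \<in> Z q \<and> t \<notin> Z q" by metis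
  show ?thesis
  proof (rule that)
    show "tight T r y (\<Union>q\<in>{t<..T}. Z q)"
      using Z by (intro tight_UN assms) auto
  qed (use Z in auto)
qed

text \<open>\<open>max\<close> and \<open>min\<close> retain from the online minimization only that,
  with earlier stages fixed, \<open>y s\<close> cannot move up towards \<open>x s\<close> and
  \<open>y t\<close> cannot drop into the window starting at \<open>d\<close>. If
  \<open>d < y t\<close>, the blocking tight sets have a union on whose complement the totals of
  \<open>x\<close> and \<open>y\<close> contradict each other.\<close>

lemma greedy_le_of_base:
  assumes sub: "submodular T r" "r {} = 0" and xy: "x \<in> base_polyhedron T r" "y \<in> base_polyhedron T r"
    and t: "t \<in> {1..T}" "x t < y t"
    and max: "\<And>s z. s \<in> {1..T} \<Longrightarrow> y s < x s \<Longrightarrow> z \<in> base_polyhedron T r \<Longrightarrow>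
                (\<forall>q\<in>{1..<s}. z q = y q) \<Longrightarrow> z s \<notin> {y s<..x s}"
    and min: "\<And>z. z \<in> base_polyhedron T r \<Longrightarrow> (\<forall>q\<in>{1..<t}. z q = y q) \<Longrightarrow> z t \<notin> {d..<y t}"
  shows "y t \<le> d"
proof (rule ccontr)
  assume "\<not> y t \<le> d"
  then obtain Z where Z: "tight T r y Z" "t \<notin> Z" "{t<..T} \<subseteq> Z"
    using tight_suffix_of_no_decrease[OF sub xy(2) t(1)] min by (metis not_le)
  define I where "I = {s \<in> {1..<t}. y s < x s}"
  have "\<exists>W. tight T r y W \<and> s \<in> W \<and> W \<subseteq> {1..s}" if "s \<in> I" for s
  proof -
    have s: "s \<in> {1..T}" "y s < x s" using that t(1) by (auto simp: I_def)
    show ?thesis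
      by (rule tight_prefix_of_no_increase[OF sub(1) xy(2) s]) (use max[OF s] in blast)+
  qed
  then obtain W where W: "\<And>s. s \<in> I \<Longrightarrow> tight T r y (W s) \<and> s \<in> W s \<and> W s \<subseteq> {1..s}" by metis
  \<comment> \<open>\<open>Z\<close> absorbs all stages after \<open>t\<close>, the sets
    \<open>W s\<close> absorb the earlier ones where \<open>x\<close> exceeds \<open>y\<close>, and
    \<open>t\<close> stays outside because \<open>W s \<subseteq> {1..s}\<close> with
    \<open>s < t\<close>.\<close>
  define U where "U = Z \<union> (\<Union>s\<in>I. W s)"
  have U: "tight T r y U"
    unfolding U_def using W
    by (intro tight_Un_Int(1)[OF sub(1) xy(2) Z(1)] tight_UN[OF sub xy(2)]) (auto simp: I_def)
  have tU: "t \<notin> U" using Z W by (force simp: U_def I_def)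
  have "x s \<le> y s" if "s \<in> {1..T} - U" for s
  proof (rule ccontr)
    assume "\<not> x s \<le> y s"
    moreover have "\<not> t < s" using that Z(3) by (auto simp: U_def)
    ultimately have "s \<in> I" using that t(2) by (cases "s = t") (auto simp: I_def)
    then show False using W that by (auto simp: U_def)
  qed
  then have less: "sum x ({1..T} - U) < sum y ({1..T} - U)"
    using t tU by (intro sum_strict_mono_ex1) auto
  have split: "r {1..T} = sum z ({1..T} - U) + sum z U" if "z \<in> base_polyhedron T r" for z
  proof -
    have "sum z {1..T} = sum z ({1..T} - U) + sum z U"
      using U by (intro sum.subset_diff) (simp_all add: tight_def)
    with that show ?thesis by (simp add: base_polyhedron_def)
  qed
  \<comment> \<open>Here \<open>y\<close> exhausts \<open>r U\<close> while \<open>x\<close> only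
    obeys the bound; as both have total \<open>r {1..T}\<close>, \<open>x\<close> has at least as
    much mass as \<open>y\<close> outside \<open>U\<close>.\<close>
  have "sum x U \<le> sum y U"
    using U base_polyhedron_sum_le[OF xy(1)] by (simp add: tight_def)
  with less split[OF xy(1)] split[OF xy(2)] show False by linarith
qed

section \<open>Existence of the online solution\<close>

lemma is_arg_min_arg_min_on:
  assumes "\<exists>y. is_arg_min g (\<lambda>y. y \<in> S) y"
  shows "is_arg_min g (\<lambda>y. y \<in> S) (arg_min_on g S)"
  unfolding arg_min_on_def arg_min_def using assms by (rule someI_ex)

text \<open>A Weierstrass argument on the bases with a prescribed prefix. Coordinates outside the
  ground set are free, so this set of functions is not compact; the minimum is first found on its
  truncated part.\<close>

lemma ex_arg_min_base_polyhedron: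
  fixes g :: "real \<Rightarrow> real"
  assumes "t \<in> {1..T}" and g: "continuous_on (local_set T r t) g"
    and z: "z \<in> base_polyhedron T r" "\<forall>s\<in>{1..<t}. z s = p s"
  shows "\<exists>y. is_arg_min g
           (\<lambda>y. y \<in> {y. \<exists>x\<in>base_polyhedron T r. (\<forall>s\<in>{1..<t}. x s = p s) \<and> x t = y}) y"
proof -
  \<comment> \<open>A product of compact intervals, with \<open>{0}\<close> for the coordinates
    outside the ground set; compact by Tychonoff.\<close>
  define P where "P = PiE UNIV (\<lambda>s. if s \<in> {1..T} then local_set T r s else {0})"
  define A where "A = base_polyhedron T r \<inter> {x. \<forall>s\<in>{1..<t}. x s = p s}"
  have P: "compact P"
    unfolding P_def
    by (simp flip: compactin_euclidean_iff euclidean_product_topology)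
      (auto simp: compactin_PiE local_set_def)
  have cont: "continuous_on UNIV (\<lambda>x::nat \<Rightarrow> real. \<Sum>i\<in>X. x i)" for X
    by (rule continuous_on_sum) (rule continuous_on_product_coordinates)
  have eq: "A = (\<Inter>X\<in>{X. X \<subset> {1..T}}. {x. sum x X \<le> r X}) \<inter> {x. sum x {1..T} = r {1..T}}
      \<inter> (\<Inter>s\<in>{1..<t}. {x. x s = p s})"
    unfolding A_def base_polyhedron_def by blast
  have "closed A"
    unfolding eq
    by (rule closed_Int closed_INT ballI closed_Collect_le[OF cont continuous_on_const]
        closed_Collect_eq[OF cont continuous_on_const]
        closed_Collect_eq[OF continuous_on_product_coordinates continuous_on_const])+
  with P have cpt: "compact (P \<inter> A)" by (rule compact_Int_closed)
  \<comment> \<open>Truncation keeps coordinate \<open>t\<close>, so a minimum over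
    \<open>P \<inter> A\<close> is one over all of \<open>A\<close>.\<close>
  define restr where "restr x = (\<lambda>s. if s \<in> {1..T} then x s else 0)" for x :: "nat \<Rightarrow> real"
  have restr: "restr x \<in> P \<inter> A" if "x \<in> A" for x
  proof -
    have "restr x \<in> base_polyhedron T r"
      by (rule base_polyhedron_cong[of x]) (use that in \<open>auto simp: A_def restr_def\<close>)
    moreover have "restr x s = p s" if "s \<in> {1..<t}" for s
      using \<open>x \<in> A\<close> that assms(1) by (auto simp: A_def restr_def)
    moreover have "restr x s \<in> (if s \<in> {1..T} then local_set T r s else {0})" for s
      using base_polyhedron_local_set[OF calculation(1), of s] by (simp add: restr_def)
    ultimately show ?thesis by (simp add: A_def P_def PiE_iff)
  qed
  have "z \<in> A" using z by (simp add: A_def)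
  then have ne: "P \<inter> A \<noteq> {}" using restr by blast
  have "continuous_on (P \<inter> A) (\<lambda>x. g (x t))"
  proof (rule continuous_on_compose2[OF g])
    show "continuous_on (P \<inter> A) (\<lambda>x. x t)"
      by (rule continuous_on_subset[OF continuous_on_product_coordinates]) simp
    show "(\<lambda>x. x t) ` (P \<inter> A) \<subseteq> local_set T r t"
      using assms(1) base_polyhedron_local_set by (auto simp: A_def)
  qed
  from continuous_attains_inf[OF cpt ne this]
  obtain x where x: "x \<in> P \<inter> A" and min: "\<And>y. y \<in> P \<inter> A \<Longrightarrow> g (x t) \<le> g (y t)" by blast
  have "g (x t) \<le> g (y t)" if "y \<in> A" for y
    using min[OF restr[OF that]] assms(1) by (simp add: restr_def)
  with x show ?thesis
    by (intro exI[of _ "x t"]) (auto simp: is_arg_min_linorder A_def)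
qed

text \<open>Every prefix of the online solution extends to a base, by induction: an extension of the
  first stages makes the next projected set nonempty, hence \<open>arg_min_on\<close> returns a true
  minimizer there, and membership in the projected set supplies the next extension.\<close>

lemma online_solution_props:
  assumes ne: "base_polyhedron T r \<noteq> {}"
    and cont: "\<And>t. t \<in> {1..T} \<Longrightarrow> continuous_on (local_set T r t) (local_lagrangian T f \<mu> l t)"
  shows "online_solution T r f \<mu> l \<in> base_polyhedron T r"
    and "\<And>t z. t \<in> {1..T} \<Longrightarrow> z \<in> base_polyhedron T r \<Longrightarrow>
           (\<forall>s\<in>{1..<t}. z s = online_solution T r f \<mu> l s) \<Longrightarrow>
           local_lagrangian T f \<mu> l t (online_solution T r f \<mu> l t) \<le> local_lagrangian T f \<mu> l t (z t)"
proof -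
  let ?y = "online_solution T r f \<mu> l"
  let ?S = "\<lambda>t. {y. \<exists>x\<in>base_polyhedron T r. (\<forall>s\<in>{1..<t}. x s = ?y s) \<and> x t = y}"
  have step: "is_arg_min (local_lagrangian T f \<mu> l t) (\<lambda>y. y \<in> ?S t) (?y t)"
    if "t \<in> {1..T}" "z \<in> base_polyhedron T r" "\<forall>s\<in>{1..<t}. z s = ?y s" for t z
  proof -
    have "is_arg_min (local_lagrangian T f \<mu> l t) (\<lambda>y. y \<in> ?S t)
        (arg_min_on (local_lagrangian T f \<mu> l t) (?S t))"
      by (intro is_arg_min_arg_min_on ex_arg_min_base_polyhedron[OF that(1) cont[OF that(1)] that(2,3)])
    moreover have eq: "?y t = arg_min_on (local_lagrangian T f \<mu> l t) (?S t)"
      by (rule online_solution.simps)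
    ultimately show ?thesis by (subst eq)
  qed
  have "\<exists>x\<in>base_polyhedron T r. \<forall>s\<in>{1..t}. x s = ?y s" if "t \<le> T" for t
    using that
  proof (induction t)
    case 0
    then show ?case using ne by auto
  next
    case (Suc t)
    then obtain z where "z \<in> base_polyhedron T r" "\<forall>s\<in>{1..<Suc t}. z s = ?y s"
      by (auto simp: atLeastLessThanSuc_atLeastAtMost)
    from step[OF _ this] Suc.prems obtain x
      where x: "x \<in> base_polyhedron T r" "\<forall>s\<in>{1..<Suc t}. x s = ?y s" "x (Suc t) = ?y (Suc t)"
      by (auto simp: is_arg_min_def)
    then have "\<forall>s\<in>{1..Suc t}. x s = ?y s"
      by (metis atLeastAtMost_iff atLeastLessThan_iff le_neq_implies_less)
    with x(1) show ?case by blast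
  qed
  from this[of T] show "?y \<in> base_polyhedron T r"
    using base_polyhedron_cong by blast
  show "local_lagrangian T f \<mu> l t (?y t) \<le> local_lagrangian T f \<mu> l t (z t)"
    if "t \<in> {1..T}" "z \<in> base_polyhedron T r" "\<forall>s\<in>{1..<t}. z s = ?y s" for t z
    using step[OF that] that by (auto simp: is_arg_min_linorder)
qed

section \<open>Unimodal functions\<close>

text \<open>The shape of a local Lagrangian with stationary point \<open>u\<close>. The comparisons
  of minimizers rest on these two strictly monotone branches in place of convexity.\<close>

definition unimodal_on :: "real set \<Rightarrow> (real \<Rightarrow> real) \<Rightarrow> real \<Rightarrow> bool" where
  "unimodal_on S g u \<longleftrightarrow> u \<in> S \<and>
     (\<forall>v\<in>S. \<forall>w\<in>S. v < w \<longrightarrow> (w \<le> u \<longrightarrow> g w < g v) \<and> (u \<le> v \<longrightarrow> g v < g w))"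

text \<open>If \<open>w < x\<close>, the point \<open>max y w\<close> still lies in the segment and
  on the increasing branch, so \<open>g\<close> is smaller there than at \<open>x\<close>.\<close>

lemma unimodal_on_minimizer_le:
  assumes "unimodal_on S g w" "{y..x} \<subseteq> S" "y < x" "\<And>v. v \<in> {y..x} \<Longrightarrow> g x \<le> g v"
  shows "x \<le> w"
proof (rule ccontr)
  assume "\<not> x \<le> w"
  then have "max y w \<in> {y..x}" "w \<le> max y w" "max y w < x" using assms(3) by auto
  moreover have "x \<in> S" "max y w \<in> S" using assms(2,3) calculation(1) by auto
  ultimately have "g (max y w) < g x" using assms(1) unfolding unimodal_on_def by blast
  with assms(4)[OF \<open>max y w \<in> {y..x}\<close>] show False by simp
qed

lemma unimodal_on_le_minimizer:
  assumes "unimodal_on S g w" "{x..y} \<subseteq> S" "x < y" "\<And>v. v \<in> {x..y} \<Longrightarrow> g x \<le> g v"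
  shows "w \<le> x"
proof (rule ccontr)
  assume "\<not> w \<le> x"
  then have "min y w \<in> {x..y}" "min y w \<le> w" "x < min y w" using assms(3) by auto
  moreover have "x \<in> S" "min y w \<in> S" using assms(2,3) calculation(1) by auto
  ultimately have "g (min y w) < g x" using assms(1) unfolding unimodal_on_def by blast
  with assms(4)[OF \<open>min y w \<in> {x..y}\<close>] show False by simp
qed

lemma unimodal_on_minimizer_unique:
  assumes g: "unimodal_on S g w" and "{a..b} \<subseteq> S" "x \<in> {a..b}" "y \<in> {a..b}"
    and min: "\<And>v. v \<in> {a..b} \<Longrightarrow> g x \<le> g v" "\<And>v. v \<in> {a..b} \<Longrightarrow> g y \<le> g v"
  shows "x = y"
proof -
  have False if "p < q" "p \<in> {a..b}" "q \<in> {a..b}"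
    "\<And>v. v \<in> {a..b} \<Longrightarrow> g p \<le> g v" "\<And>v. v \<in> {a..b} \<Longrightarrow> g q \<le> g v" for p q
  proof -
    have "{p..q} \<subseteq> {a..b}" using that by auto
    then have "q \<le> w" "w \<le> p"
      using that assms(2) unimodal_on_minimizer_le[OF g, of p q] unimodal_on_le_minimizer[OF g, of p q]
      by blast+
    with \<open>p < q\<close> show False by simp
  qed
  then show ?thesis using assms(3,4) min by (metis linorder_less_linear)
qed

section \<open>Gradients of scaled power costs\<close>

text \<open>The case \<open>x = 0\<close> matters since a domain may reach the zero of its affine
  argument. There the difference quotient is \<open>y powr (c - 1)\<close>, which tends to
  \<open>0\<close> as \<open>c > 1\<close>.\<close>

lemma has_real_derivative_powr_nonneg:
  fixes c x :: real
  assumes "1 < c" "0 \<le> x"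
  shows "((\<lambda>y. y powr c) has_real_derivative c * x powr (c - 1)) (at x within {0..})"
proof (cases "x = 0")
  case False
  then show ?thesis
    using assms by (intro has_field_derivative_at_within[OF has_real_derivative_powr]) auto
next
  case True
  have "((\<lambda>y::real. y powr (c - 1)) \<longlongrightarrow> 0 powr (c - 1)) (at 0 within {0..})"
    using assms by (intro tendsto_powr' tendsto_const tendsto_ident_at)
      (auto simp: eventually_at_filter)
  moreover have "eventually (\<lambda>y::real. y powr (c - 1) = (y powr c - 0 powr c) / (y - 0)) (at 0 within {0..})"
    by (auto simp: eventually_at_filter powr_diff)
  ultimately have "((\<lambda>y::real. (y powr c - 0 powr c) / (y - 0)) \<longlongrightarrow> 0) (at 0 within {0..})"
    using assms by (simp add: tendsto_cong)
  then show ?thesis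
    using True assms by (simp add: has_field_derivative_iff)
qed

text \<open>The outer factor \<open>a\<close> cancels the inner derivative
  \<open>1 / a\<close>.\<close>

lemma has_real_derivative_scaled_power_cost:
  assumes "0 < a" "1 < c" and nonneg: "\<And>x. x \<in> S \<Longrightarrow> 0 \<le> x / a + b" and x: "x \<in> S"
    and g: "\<And>x. x \<in> S \<Longrightarrow> g x = a * power_cost K c (x / a + b)"
  shows "(g has_real_derivative K * c * (x / a + b) powr (c - 1)) (at x within S)"
proof -
  let ?h = "\<lambda>x. x / a + b"
  have "((\<lambda>y. y powr c) has_real_derivative c * (?h x) powr (c - 1)) (at (?h x) within ?h ` S)"
    by (rule DERIV_subset[OF has_real_derivative_powr_nonneg]) (use assms in auto)
  moreover have "(?h has_real_derivative 1 / a) (at x within S)"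
    using assms(1) by (auto intro!: derivative_eq_intros)
  ultimately have "((\<lambda>y. y powr c) \<circ> ?h has_real_derivative c * (?h x) powr (c - 1) * (1 / a)) (at x within S)"
    by (rule DERIV_image_chain)
  then have "((\<lambda>x. a * K * ((\<lambda>y. y powr c) \<circ> ?h) x) has_real_derivative
      a * K * (c * (?h x) powr (c - 1) * (1 / a))) (at x within S)"
    by (rule DERIV_cmult)
  also have "a * K * (c * (?h x) powr (c - 1) * (1 / a)) = K * c * (?h x) powr (c - 1)"
    using assms(1) by simp
  finally show ?thesis
    by (rule has_field_derivative_transform_within[where d = 1]) (use x g in \<open>auto simp: power_cost_def\<close>)
qed

text \<open>An interval with nonempty interior has no isolated points, so the relative derivative is
  unique and \<open>grad_on\<close> returns it.\<close>

lemma grad_on_scaled_power_cost: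
  assumes "is_interval S" "interior S \<noteq> {}" "0 < a" "1 < c"
    and "\<And>x. x \<in> S \<Longrightarrow> 0 \<le> x / a + b" "x \<in> S"
    and "\<And>x. x \<in> S \<Longrightarrow> g x = a * power_cost K c (x / a + b)"
  shows "grad_on S g x = K * c * (x / a + b) powr (c - 1)"
proof -
  have "S \<noteq> {v}" for v using assms(2) by auto
  then have "x islimpt S"
    using assms(1,6) by (intro connected_imp_perfect is_interval_connected) auto
  then have "at x within S \<noteq> bot" by (simp add: trivial_limit_within)
  then show ?thesis
    unfolding grad_on_def
    using has_real_derivative_scaled_power_cost[OF assms(3,4,5,6,7)]
    by (intro vector_derivative_within) (auto simp: has_real_derivative_iff_has_vector_derivative)
qed

lemma inv_grad_on_mem:
  assumes "\<nu> \<in> grad_on S g ` S"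
  shows "inv_grad_on S g \<nu> \<in> S" "grad_on S g (inv_grad_on S g \<nu>) = \<nu>"
  using assms by (simp_all add: inv_grad_on_def inv_into_into f_inv_into_f)

text \<open>The slope is written as the gradient at \<open>u\<close>, so the derivative
  \<open>d\<close> of the Lagrangian vanishes at \<open>u\<close>. As \<open>d\<close> is strictly
  increasing, it is negative to the left of \<open>u\<close> and positive to the right.\<close>

lemma unimodal_on_scaled_power_cost:
  assumes "is_interval S" "0 < a" "1 < c" "0 < K"
    and nonneg: "\<And>x. x \<in> S \<Longrightarrow> 0 \<le> x / a + b" and u: "u \<in> S"
    and g: "\<And>x. x \<in> S \<Longrightarrow> g x = a * power_cost K c (x / a + b)"
  shows "unimodal_on S (\<lambda>x. g x - K * c * (u / a + b) powr (c - 1) * x) u"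
proof -
  define d where "d x = K * c * (x / a + b) powr (c - 1) - K * c * (u / a + b) powr (c - 1)" for x
  let ?L = "\<lambda>x. g x - K * c * (u / a + b) powr (c - 1) * x"
  have der: "(?L has_real_derivative d x) (at x within S)" if "x \<in> S" for x
    unfolding d_def
    by (rule derivative_eq_intros has_real_derivative_scaled_power_cost[OF assms(2,3) nonneg that g]
        | assumption | simp)+
  have d_pos: "d x < d y" if "x \<in> S" "x < y" for x y
  proof -
    have "(x / a + b) powr (c - 1) < (y / a + b) powr (c - 1)"
      using nonneg[OF that(1)] that(2) assms(2,3)
      by (intro powr_less_mono2) (auto simp: divide_strict_right_mono)
    then show ?thesis using assms(3,4) by (simp add: d_def)
  qed
  have du: "d u = 0" by (simp add: d_def)
  have sub: "{v..w} \<subseteq> S" if "v \<in> S" "w \<in> S" for v w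
    using assms(1) that by (meson atLeastAtMost_iff mem_is_interval_1_I subsetI)
  have cont: "continuous_on {v..w} ?L" if "v \<in> S" "w \<in> S" for v w
    by (rule continuous_on_subset[OF DERIV_continuous_on[OF der] sub[OF that]])
  \<comment> \<open>The derivative is only known relative to \<open>S\<close>; strictly between two
    points of \<open>S\<close> it is two-sided, and continuity covers the endpoints.\<close>
  have der_at: "(?L has_real_derivative d x) (at x)" if "v \<in> S" "w \<in> S" "v < x" "x < w" for v w x
  proof -
    have "{v<..<w} \<subseteq> S" using sub[OF that(1,2)] by force
    then have "(?L has_real_derivative d x) (at x within {v<..<w})"
      using that by (intro DERIV_subset[OF der]) auto
    then show ?thesis using that by (simp add: at_within_open[where S = "{v<..<w}"])
  qed
  show ?thesis
    unfolding unimodal_on_def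
  proof (intro conjI ballI impI)
    fix v w assume vw: "v \<in> S" "w \<in> S" "v < w"
    have mem: "x \<in> S" if "v < x" "x < w" for x using sub[OF vw(1,2)] that by auto
    show "?L w < ?L v" if "w \<le> u"
    proof (rule DERIV_neg_imp_decreasing_open[OF vw(3) _ cont[OF vw(1,2)]])
      fix x assume x: "v < x" "x < w"
      then have "d x < 0" using d_pos[OF mem[OF x], of u] du that by simp
      with der_at[OF vw(1,2) x] show "\<exists>y. (?L has_real_derivative y) (at x) \<and> y < 0" by blast
    qed
    show "?L v < ?L w" if "u \<le> v"
    proof (rule DERIV_pos_imp_increasing_open[OF vw(3) _ cont[OF vw(1,2)]])
      fix x assume x: "v < x" "x < w"
      then have "0 < d x" using d_pos[OF u, of x] du that by simp
      with der_at[OF vw(1,2) x] show "\<exists>y. (?L has_real_derivative y) (at x) \<and> 0 < y" by blast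
    qed
  qed (rule u)
qed

text \<open>Solving the stationarity condition gives
  \<open>z powr (c - 1) = \<nu> / (c * K)\<close>; the power \<open>c / (c - 1)\<close> turns this
  into \<open>z powr c\<close>, also for \<open>z = 0\<close>.\<close>

lemma power_cost_at_stationary_point:
  fixes K c z :: real
  assumes "0 < K" "1 < c" "0 \<le> z" "\<nu> = K * c * z powr (c - 1)"
  shows "power_cost K c z = K * (1 / (c * K)) powr (c / (c - 1)) * \<nu> powr (c / (c - 1))"
proof -
  have "(1 / (c * K)) powr (c / (c - 1)) * \<nu> powr (c / (c - 1)) = (1 / (c * K) * \<nu>) powr (c / (c - 1))"
    by (rule powr_mult[symmetric])
  also have "1 / (c * K) * \<nu> = z powr (c - 1)"
    using assms by simp
  also have "(z powr (c - 1)) powr (c / (c - 1)) = z powr c"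
    using assms by (simp add: powr_powr)
  finally show ?thesis by (simp add: power_cost_def mult.assoc)
qed

lemma nu_antimono:
  assumes "mult_le T \<mu> l \<mu>' l'"
  shows "nu T \<mu>' l' t \<le> nu T \<mu> l t"
proof -
  have "(\<Sum>X\<in>{X \<in> mult_sets T. t \<in> X}. \<mu> X) \<le> (\<Sum>X\<in>{X \<in> mult_sets T. t \<in> X}. \<mu>' X)"
    using assms by (intro sum_mono) (auto simp: mult_le_def)
  then show ?thesis using assms by (simp add: nu_def mult_le_def)
qed

section \<open>Comparison of the two online solutions\<close>

text \<open>The point \<open>v\<close> serves twice: it shows that the local set is nonempty, so
  that a minimizer exists, and it is the point of comparison.\<close>

lemma local_solution_le:
  assumes "continuous_on (local_set T r t) (local_lagrangian T f \<mu> l t)" "v \<in> local_set T r t"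
  shows "local_solution T r f \<mu> l t \<in> local_set T r t"
    and "local_lagrangian T f \<mu> l t (local_solution T r f \<mu> l t) \<le> local_lagrangian T f \<mu> l t v"
proof -
  have "compact (local_set T r t)" by (simp add: local_set_def)
  then have "\<exists>y. is_arg_min (local_lagrangian T f \<mu> l t) (\<lambda>y. y \<in> local_set T r t) y"
    using continuous_attains_inf[OF _ _ assms(1)] assms(2) unfolding is_arg_min_linorder by blast
  from is_arg_min_arg_min_on[OF this]
  show "local_solution T r f \<mu> l t \<in> local_set T r t"
    and "local_lagrangian T f \<mu> l t (local_solution T r f \<mu> l t) \<le> local_lagrangian T f \<mu> l t v"
    using assms(2) by (auto simp: local_solution_def is_arg_min_linorder)
qed

text \<open>By induction the local solution, being a base, competes in each online step, so the
  online value is no worse. That value also lies in the local set, where the minimizer is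
  unique.\<close>

lemma online_solution_eq_local_solution:
  assumes x: "local_solution T r f \<mu> l \<in> base_polyhedron T r"
    and cont: "\<And>t. t \<in> {1..T} \<Longrightarrow> continuous_on (local_set T r t) (local_lagrangian T f \<mu> l t)"
    and uni: "\<And>t. t \<in> {1..T} \<Longrightarrow> unimodal_on (D t) (local_lagrangian T f \<mu> l t) (w t)"
    and sub: "\<And>t. t \<in> {1..T} \<Longrightarrow> local_set T r t \<subseteq> D t"
    and t: "t \<in> {1..T}"
  shows "online_solution T r f \<mu> l t = local_solution T r f \<mu> l t"
  using t
proof (induction t rule: less_induct)
  case (less t)
  let ?x = "local_solution T r f \<mu> l" and ?y = "online_solution T r f \<mu> l"
  note props = online_solution_props[of T r f \<mu> l, OF _ cont]
  have "\<forall>s\<in>{1..<t}. ?x s = ?y s" using less by auto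
  then have le: "local_lagrangian T f \<mu> l t (?y t) \<le> local_lagrangian T f \<mu> l t (?x t)"
    using props(2)[OF _ _ less.prems x] x by blast
  have y: "?y t \<in> local_set T r t"
    using base_polyhedron_local_set props(1) x less.prems by blast
  have min: "local_lagrangian T f \<mu> l t (?x t) \<le> local_lagrangian T f \<mu> l t v" if "v \<in> local_set T r t" for v
    by (rule local_solution_le[OF cont[OF less.prems] that])
  show ?case
    using sub[OF less.prems] y local_solution_le(1)[OF cont[OF less.prems] y] min le
    unfolding local_set_def
    by (intro unimodal_on_minimizer_unique[OF uni[OF less.prems]]) fastforce+
qed

text \<open>The first bound compares \<open>x t\<close> with the larger value \<open>y t\<close> in
  the same local set; the second is \<open>greedy_le_of_base\<close> with
  \<open>d = u t\<close>.\<close>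

lemma online_solution_between:
  fixes T :: nat and f :: "nat \<Rightarrow> real \<Rightarrow> real"
  defines "L \<equiv> local_lagrangian T f"
  assumes r: "submodular T r" "r {} = 0"
    and x: "local_solution T r f \<mu> l \<in> base_polyhedron T r"
    and cont: "\<And>t \<mu> l. t \<in> {1..T} \<Longrightarrow> continuous_on (local_set T r t) (L \<mu> l t)"
    and w: "\<And>t. t \<in> {1..T} \<Longrightarrow> unimodal_on (D t) (L \<mu> l t) (w t)"
    and u: "\<And>t. t \<in> {1..T} \<Longrightarrow> unimodal_on (D t) (L \<mu>' l' t) (u t)"
    and wu: "\<And>t. t \<in> {1..T} \<Longrightarrow> w t \<le> u t"
    and sub: "\<And>t. t \<in> {1..T} \<Longrightarrow> local_set T r t \<subseteq> D t"
    and t: "t \<in> {1..T}" "local_solution T r f \<mu> l t < online_solution T r f \<mu>' l' t"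
  shows "w t \<le> local_solution T r f \<mu> l t" and "online_solution T r f \<mu>' l' t \<le> u t"
proof -
  define x where "x = local_solution T r f \<mu> l"
  define y where "y = online_solution T r f \<mu>' l'"
  have xB: "x \<in> base_polyhedron T r" using assms(4) by (simp add: x_def)
  have ymin: "L \<mu>' l' s (y s) \<le> L \<mu>' l' s (z s)"
    if "s \<in> {1..T}" "z \<in> base_polyhedron T r" "\<forall>q\<in>{1..<s}. z q = y q" for s z
    using online_solution_props[of T r f \<mu>' l'] cont xB that unfolding y_def L_def by blast+
  have yB: "y \<in> base_polyhedron T r"
    unfolding y_def using online_solution_props(1)[of T r f \<mu>' l'] cont xB unfolding L_def by blast
  have loc: "x s \<in> local_set T r s" "y s \<in> local_set T r s" if "s \<in> {1..T}" for s
    using that xB yB base_polyhedron_local_set by blast+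
  have seg: "{x s..y s} \<subseteq> local_set T r s" "{y s..x s} \<subseteq> local_set T r s" if "s \<in> {1..T}" for s
    using loc[OF that] by (auto simp: local_set_def)
  have xmin: "L \<mu> l s (x s) \<le> L \<mu> l s v" if "s \<in> {1..T}" "v \<in> local_set T r s" for s v
    unfolding x_def L_def using cont that by (intro local_solution_le) (auto simp: L_def)
  show "w t \<le> local_solution T r f \<mu> l t"
    using unimodal_on_le_minimizer[OF w, of t "x t" "y t"] seg[OF t(1)] sub[OF t(1)] xmin[OF t(1)] t
    by (force simp: x_def y_def)
  have "y t \<le> u t"
  proof (rule greedy_le_of_base[OF r xB yB])
    show "t \<in> {1..T}" "x t < y t" using t by (auto simp: x_def y_def)
  next
    fix s z assume s: "s \<in> {1..T}" "y s < x s"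
      and z: "z \<in> base_polyhedron T r" "\<forall>q\<in>{1..<s}. z q = y q"
    \<comment> \<open>Room to the left of \<open>x s\<close> gives
      \<open>x s \<le> w s \<le> u s\<close>. So the Lagrangian for \<open>\<mu>'\<close> decreases
      strictly on \<open>{y s..x s}\<close>, and a base with the same prefix and a value in
      \<open>{y s<..x s}\<close> would beat \<open>y s\<close>.\<close>
    have "x s \<le> w s"
      using unimodal_on_minimizer_le[OF w, of s "y s" "x s"] seg[OF s(1)] sub[OF s(1)] xmin[OF s(1)] s
      by force
    then have "x s \<le> u s" using wu[OF s(1)] by simp
    moreover have "y s \<in> D s" "z s \<in> D s"
      using sub[OF s(1)] loc[OF s(1)] base_polyhedron_local_set[OF z(1) s(1)] by auto
    ultimately show "z s \<notin> {y s<..x s}"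
      using u[OF s(1)] ymin[OF s(1) z] unfolding unimodal_on_def
      by (metis greaterThanAtMost_iff leD order_trans)
  next
    fix z assume z: "z \<in> base_polyhedron T r" "\<forall>q\<in>{1..<t}. z q = y q"
    \<comment> \<open>From \<open>u t\<close> on the Lagrangian increases, so a base with its value
      in the window would beat \<open>y t\<close>.\<close>
    have "y t \<in> D t" "z t \<in> D t"
      using sub[OF t(1)] loc[OF t(1)] base_polyhedron_local_set[OF z(1) t(1)] by auto
    then show "z t \<notin> {u t..<y t}"
      using u[OF t(1)] ymin[OF t(1) z] unfolding unimodal_on_def
      by (metis atLeastLessThan_iff leD)
  qed
  then show "online_solution T r f \<mu>' l' t \<le> u t" by (simp add: y_def)
qed

section \<open>Closed form of the stationary costs and stagewise cost comparison\<close>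

theorem corollary2:
  fixes K c :: real
    and T :: nat
    and r :: "nat set \<Rightarrow> real"
    and D :: "nat \<Rightarrow> real set"
    and f :: "nat \<Rightarrow> real \<Rightarrow> real"
    and a b :: "nat \<Rightarrow> real"
    and \<mu>_opt \<mu>_hat :: "nat set \<Rightarrow> real"
    and l_opt l_hat :: real
  assumes "K > 0" and "c > 1"
    and "I_sub T r D f"
    and "\<And>t. t \<in> {1..T} \<Longrightarrow> a t > 0"
    and "\<And>t x. t \<in> {1..T} \<Longrightarrow> x \<in> D t \<Longrightarrow> x / a t + b t \<ge> 0"
    and "\<And>t x. t \<in> {1..T} \<Longrightarrow> x \<in> D t \<Longrightarrow> f t x = a t * power_cost K c (x / a t + b t)"
    and "optimal_multipliers T r f \<mu>_opt l_opt"
    and "mult_le T \<mu>_hat l_hat \<mu>_opt l_opt"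
    and "\<And>t. t \<in> {1..T} \<Longrightarrow> nu T \<mu>_hat l_hat t \<in> grad_on (D t) (f t) ` D t"
    and "\<And>t. t \<in> {1..T} \<Longrightarrow> nu T \<mu>_opt l_opt t \<in> grad_on (D t) (f t) ` D t"
  shows "(\<Sum>t\<in>{1..T}. f t (inv_grad_on (D t) (f t) (nu T \<mu>_hat l_hat t)))
           - (\<Sum>t\<in>{1..T}. f t (inv_grad_on (D t) (f t) (nu T \<mu>_opt l_opt t)))
         = K * (1 / (c * K)) powr (c / (c - 1)) *
             ((\<Sum>t\<in>{1..T}. a t * nu T \<mu>_hat l_hat t powr (c / (c - 1)))
              - (\<Sum>t\<in>{1..T}. a t * nu T \<mu>_opt l_opt t powr (c / (c - 1))))
       \<and> (\<Sum>t\<in>{1..T}. f t (online_solution T r f \<mu>_hat l_hat t))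
           - (\<Sum>t\<in>{1..T}. f t (online_solution T r f \<mu>_opt l_opt t))
         \<le> K * (1 / (c * K)) powr (c / (c - 1)) *
             ((\<Sum>t\<in>{1..T}. a t * nu T \<mu>_hat l_hat t powr (c / (c - 1)))
              - (\<Sum>t\<in>{1..T}. a t * nu T \<mu>_opt l_opt t powr (c / (c - 1))))"
proof -
  let ?C = "K * (1 / (c * K)) powr (c / (c - 1))"
  define u where "u t = inv_grad_on (D t) (f t) (nu T \<mu>_hat l_hat t)" for t
  define w where "w t = inv_grad_on (D t) (f t) (nu T \<mu>_opt l_opt t)" for t
  define x where "x = local_solution T r f \<mu>_opt l_opt"
  define y where "y = online_solution T r f \<mu>_hat l_hat"
  note I = assms(3)[unfolded I_sub_def]
  have D: "is_interval (D t)" "interior (D t) \<noteq> {}" "local_set T r t \<subseteq> D t" "mono_on (D t) (f t)"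
    "f t differentiable_on D t" if "t \<in> {1..T}" for t
    using I that by (auto simp: continuously_differentiable_on_def)
  have grad: "grad_on (D t) (f t) v = K * c * (v / a t + b t) powr (c - 1)"
    if "t \<in> {1..T}" "v \<in> D t" for t v
    using D[OF that(1)] assms that by (intro grad_on_scaled_power_cost) auto
  have uD: "u t \<in> D t" and u: "nu T \<mu>_hat l_hat t = K * c * (u t / a t + b t) powr (c - 1)"
    if "t \<in> {1..T}" for t
    using inv_grad_on_mem[OF assms(9)[OF that]] grad[OF that] unfolding u_def by auto
  have wD: "w t \<in> D t" and w: "nu T \<mu>_opt l_opt t = K * c * (w t / a t + b t) powr (c - 1)"
    if "t \<in> {1..T}" for t
    using inv_grad_on_mem[OF assms(10)[OF that]] grad[OF that] unfolding w_def by auto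
  have fu: "f t (u t) = ?C * (a t * nu T \<mu>_hat l_hat t powr (c / (c - 1)))" if "t \<in> {1..T}" for t
    using power_cost_at_stationary_point[OF assms(1,2) assms(5)[OF that uD[OF that]] u[OF that]]
      assms(6)[OF that uD[OF that]] by simp
  have fw: "f t (w t) = ?C * (a t * nu T \<mu>_opt l_opt t powr (c / (c - 1)))" if "t \<in> {1..T}" for t
    using power_cost_at_stationary_point[OF assms(1,2) assms(5)[OF that wD[OF that]] w[OF that]]
      assms(6)[OF that wD[OF that]] by simp
  have eq: "(\<Sum>t\<in>{1..T}. f t (u t)) - (\<Sum>t\<in>{1..T}. f t (w t)) =
      ?C * ((\<Sum>t\<in>{1..T}. a t * nu T \<mu>_hat l_hat t powr (c / (c - 1)))
            - (\<Sum>t\<in>{1..T}. a t * nu T \<mu>_opt l_opt t powr (c / (c - 1))))"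
    using fu fw by (simp add: sum_distrib_left right_diff_distrib)

  \<comment> \<open>Smaller multipliers mean a larger \<open>nu\<close>, and the gradient is
    strictly increasing.\<close>
  have wu: "w t \<le> u t" if t: "t \<in> {1..T}" for t
  proof (rule ccontr)
    assume "\<not> w t \<le> u t"
    then have "(u t / a t + b t) powr (c - 1) < (w t / a t + b t) powr (c - 1)"
      using assms(2) assms(4)[OF t] assms(5)[OF t uD[OF t]]
      by (intro powr_less_mono2) (auto simp: divide_strict_right_mono)
    then have "nu T \<mu>_hat l_hat t < nu T \<mu>_opt l_opt t"
      using u[OF t] w[OF t] assms(1,2) by simp
    then show False using nu_antimono[OF assms(8), of t] by simp
  qed
  have cont: "continuous_on (local_set T r t) (local_lagrangian T f \<mu> l t)"
    if "t \<in> {1..T}" for t \<mu> l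
  proof -
    have "continuous_on (local_set T r t) (f t)"
      using D[OF that] differentiable_imp_continuous_on continuous_on_subset by blast
    then show ?thesis
      unfolding local_lagrangian_def by (intro continuous_intros)
  qed
  have uni_u: "unimodal_on (D t) (local_lagrangian T f \<mu>_hat l_hat t) (u t)" if "t \<in> {1..T}" for t
    unfolding local_lagrangian_def u[OF that]
    using D[OF that] assms uD that by (intro unimodal_on_scaled_power_cost) auto
  have uni_w: "unimodal_on (D t) (local_lagrangian T f \<mu>_opt l_opt t) (w t)" if "t \<in> {1..T}" for t
    unfolding local_lagrangian_def w[OF that]
    using D[OF that] assms wD that by (intro unimodal_on_scaled_power_cost) auto
  have xB: "x \<in> base_polyhedron T r"
    using assms(7) by (simp add: x_def optimal_multipliers_def optimal_solution_def is_arg_min_def)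
  have yB: "y \<in> base_polyhedron T r"
    unfolding y_def using xB cont by (intro online_solution_props) auto
  \<comment> \<open>At the optimal multipliers the local solutions form a base, so the online
    solution reproduces them.\<close>
  have online_x: "online_solution T r f \<mu>_opt l_opt t = x t" if "t \<in> {1..T}" for t
    unfolding x_def
    by (rule online_solution_eq_local_solution[OF xB[unfolded x_def] cont uni_w D(3) that])
  have between: "w t \<le> x t" "y t \<le> u t" if "t \<in> {1..T}" "x t < y t" for t
    using online_solution_between[OF _ _ xB[unfolded x_def] cont uni_w uni_u wu D(3)
        that[unfolded x_def y_def]] I unfolding x_def y_def by blast+
  have le: "f t (y t) - f t (x t) \<le> f t (u t) - f t (w t)" if t: "t \<in> {1..T}" for t
  proof -
    have mem: "x t \<in> D t" "y t \<in> D t"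
      using D(3)[OF t] base_polyhedron_local_set[OF _ t] xB yB by blast+
    note mono = mono_onD[OF D(4)[OF t]]
    show ?thesis
    proof (cases "x t < y t")
      case True
      then show ?thesis
        using mono[OF wD[OF t] mem(1)] mono[OF mem(2) uD[OF t]] between[OF t] by simp
    next
      case False
      then show ?thesis
        using mono[OF mem(2,1)] mono[OF wD[OF t] uD[OF t] wu[OF t]] by simp
    qed
  qed
  have "(\<Sum>t\<in>{1..T}. f t (y t)) - (\<Sum>t\<in>{1..T}. f t (online_solution T r f \<mu>_opt l_opt t))
      = (\<Sum>t\<in>{1..T}. f t (y t) - f t (x t))"
    using online_x by (simp add: sum_subtractf)
  also have "\<dots> \<le> (\<Sum>t\<in>{1..T}. f t (u t) - f t (w t))"
    using le by (rule sum_mono)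
  also have "\<dots> = (\<Sum>t\<in>{1..T}. f t (u t)) - (\<Sum>t\<in>{1..T}. f t (w t))"
    by (rule sum_subtractf)
  finally show ?thesis
    using eq unfolding u_def w_def y_def by simp
qed

end
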